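(* Let $D$ be the formal derivative of the context-free grammar $G=\{x\rightarrow xy,\ y\rightarrow yz,\ z\rightarrow y^2\}$, i.e. the derivation on polynomials in the commuting indeterminates $x,y,z$ determined by $D(x)=xy$, $D(y)=yz$, $D(z)=y^2$. Then for every integer $n\ge 1$, $$D^{n}(x^2)=x^2\sum_{k=1}^{n}R(n+1,k)\,y^kz^{n-k}$$ and $$D^n(x)=x\sum_{k=1}^n a_k(n)\,y^kz^{n-k}.$$
   Context: $\mathfrak{S}_n$ is the set of permutations $\pi=\pi(1)\cdots\pi(n)$ of $\{1,\ldots,n\}$. A permutation $\pi\in\mathfrak{S}_n$ changes direction at position $i\in\{2,\ldots,n-1\}$ if $\pi(i-1)<\pi(i)>\pi(i+1)$ or $\pi(i-1)>\pi(i)<\pi(i+1)$. For $n\ge 2$, $\pi$ has $k$ alternating runs if it changes direction at exactly $k-1$ positions, and $R(n,k)$ is the number of permutations in $\mathfrak{S}_n$ with $k$ alternating runs. An alternating subsequence of $\pi$ of length $k$ is a subsequence $\pi(i_1),\ldots,\pi(i_k)$ with $i_1<\cdots<i_k$ and $\pi(i_1)>\pi(i_2)<\pi(i_3)>\cdots\pi(i_k)$ (starting with a descent and alternating thereafter; any sequence of length 1 qualifies). $\mathrm{as}(\pi)$ is the maximal length of an alternating subsequence of $\pi$, and $a_k(n)=\#\{\pi\in\mathfrak{S}_n:\mathrm{as}(\pi)=k\}$. The formal derivative $D$ of a grammar is the linear operator satisfying the Leibniz rule $D(uv)=D(u)v+uD(v)$ that sends each letter to the expression it is replaced by; $D^n$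 denotes the $n$-fold iterate. *)

theory Defs
  imports "HOL-Library.Poly_Mapping" "HOL-Combinatorics.Permutations"
begin

text \<open>
  Polynomials in commuting indeterminates from \<open>'v\<close> with coefficients in \<open>'a\<close> are finitely
  supported maps from monomials (exponent vectors) to coefficients; the product on
  \<open>\<Rightarrow>\<^sub>0\<close> is convolution.
\<close>

type_synonym ('v, 'a) polynomial = "('v \<Rightarrow>\<^sub>0 nat) \<Rightarrow>\<^sub>0 'a"

definition Var :: "'v \<Rightarrow> ('v, 'a::comm_ring_1) polynomial" where
  "Var v = Poly_Mapping.single (Poly_Mapping.single v 1) 1"

definition Const :: "'a \<Rightarrow> ('v, 'a::comm_ring_1) polynomial" where
  "Const c = Poly_Mapping.single 0 c"

text \<open>A grammar maps each letter to the polynomial that replaces it.\<close>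

definition is_formal_derivative ::
  "('v \<Rightarrow> ('v, 'a::comm_ring_1) polynomial) \<Rightarrow>
   (('v, 'a) polynomial \<Rightarrow> ('v, 'a) polynomial) \<Rightarrow> bool" where
  "is_formal_derivative G D \<longleftrightarrow>
     (\<forall>u v. D (u + v) = D u + D v) \<and>
     (\<forall>c u. D (Const c * u) = Const c * D u) \<and>
     (\<forall>u v. D (u * v) = D u * v + u * D v) \<and>
     (\<forall>a. D (Var a) = G a)"

text \<open>Existence and uniqueness are shown in \<open>ex1_formal_derivative\<close> below.\<close>

definition formal_derivative ::
  "('v \<Rightarrow> ('v, 'a::comm_ring_1) polynomial) \<Rightarrow> ('v, 'a) polynomial \<Rightarrow> ('v, 'a) polynomial" where
  "formal_derivative G = (THE D. is_formal_derivative G D)"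

lemma polynomial_induct [case_names monomial add]:
  fixes p :: "('v, 'a::comm_ring_1) polynomial"
  assumes mon: "\<And>m c. P (Poly_Mapping.single m c)"
    and add: "\<And>p q. P p \<Longrightarrow> P q \<Longrightarrow> P (p + q)"
  shows "P p"
proof (induction p rule: update_induct)
  case const
  show ?case using mon[of 0 0] by simp
next
  case (update f a b)
  have "Poly_Mapping.update a b f = f + Poly_Mapping.single a b"
    using update(1)
    by (intro poly_mapping_eqI)
       (auto simp: lookup_add lookup_update lookup_single in_keys_iff when_def)
  then show ?case using add[OF update(3) mon] by simp
qed

definition monomial_deriv ::
  "('v \<Rightarrow> ('v, 'a::comm_ring_1) polynomial) \<Rightarrow> ('v \<Rightarrow>\<^sub>0 nat) \<Rightarrow> ('v, 'a) polynomial" where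
  "monomial_deriv G m = (\<Sum>v\<in>Poly_Mapping.keys m.
     Poly_Mapping.single (m - Poly_Mapping.single v 1) (of_nat (Poly_Mapping.lookup m v)) * G v)"

definition poly_deriv ::
  "('v \<Rightarrow> ('v, 'a::comm_ring_1) polynomial) \<Rightarrow> ('v, 'a) polynomial \<Rightarrow> ('v, 'a) polynomial" where
  "poly_deriv G p =
     (\<Sum>m\<in>Poly_Mapping.keys p. Const (Poly_Mapping.lookup p m) * monomial_deriv G m)"

lemma monomial_deriv_superset:
  assumes "finite V" "Poly_Mapping.keys m \<subseteq> V"
  shows "monomial_deriv G m = (\<Sum>v\<in>V.
     Poly_Mapping.single (m - Poly_Mapping.single v 1) (of_nat (Poly_Mapping.lookup m v)) * G v)"
  unfolding monomial_deriv_def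
  by (rule sum.mono_neutral_left) (use assms in \<open>auto simp: in_keys_iff\<close>)

lemma poly_deriv_superset:
  assumes "finite M" "Poly_Mapping.keys p \<subseteq> M"
  shows "poly_deriv G p = (\<Sum>m\<in>M. Const (Poly_Mapping.lookup p m) * monomial_deriv G m)"
  unfolding poly_deriv_def
  by (rule sum.mono_neutral_left) (use assms in \<open>auto simp: in_keys_iff Const_def\<close>)

lemma monomial_deriv_add:
  "monomial_deriv G (m + n) =
     monomial_deriv G m * Poly_Mapping.single n 1 + Poly_Mapping.single m 1 * monomial_deriv G n"
proof -
  let ?V = "Poly_Mapping.keys m \<union> Poly_Mapping.keys n"
  let ?e = "\<lambda>v. Poly_Mapping.single v (1::nat)"
  let ?t = "\<lambda>m v. Poly_Mapping.single (m - ?e v) (of_nat (Poly_Mapping.lookup m v))"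
  have shift: "?t m v * Poly_Mapping.single n 1 =
      Poly_Mapping.single (m + n - ?e v) (of_nat (Poly_Mapping.lookup m v) :: 'b)"
    for m n :: "'a \<Rightarrow>\<^sub>0 nat" and v
  proof (cases "Poly_Mapping.lookup m v = 0")
    case False
    then have "m - ?e v + n = m + n - ?e v"
      by (intro poly_mapping_eqI) (auto simp: lookup_add lookup_minus lookup_single when_def)
    then show ?thesis by (simp add: mult_single)
  qed simp
  have "?t (m + n) v =
      ?t m v * Poly_Mapping.single n 1 + Poly_Mapping.single m 1 * (?t n v :: ('a, 'b) polynomial)" for v
    using shift[of m v n] shift[of n v m]
    by (simp add: lookup_add single_add mult.commute add.commute)
  then have "?t (m + n) v * G v =
      ?t m v * G v * Poly_Mapping.single n 1 + Poly_Mapping.single m 1 * (?t n v * G v)" for v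
    by (simp add: algebra_simps)
  moreover have "Poly_Mapping.keys (m + n) \<subseteq> ?V" by (rule Poly_Mapping.keys_add)
  ultimately show ?thesis
    by (simp add: monomial_deriv_superset[of ?V] sum.distrib sum_distrib_left sum_distrib_right)
qed

lemma poly_deriv_add: "poly_deriv G (p + q) = poly_deriv G p + poly_deriv G q"
proof -
  let ?M = "Poly_Mapping.keys p \<union> Poly_Mapping.keys q"
  have "Poly_Mapping.keys (p + q) \<subseteq> ?M" by (rule Poly_Mapping.keys_add)
  then show ?thesis
    by (simp add: poly_deriv_superset[of ?M] sum.distrib lookup_add Const_def single_add
        distrib_right)
qed

lemma poly_deriv_single: "poly_deriv G (Poly_Mapping.single m c) = Const c * monomial_deriv G m"
  by (subst poly_deriv_superset[of "{m}"]) auto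

lemma single_eq_Const: "Poly_Mapping.single m c = Const c * Poly_Mapping.single m 1"
  by (simp add: Const_def mult_single)

lemma Const_mult: "Const (a * b) = Const a * Const b"
  by (simp add: Const_def mult_single)

lemma poly_deriv_mult: "poly_deriv G (p * q) = poly_deriv G p * q + p * poly_deriv G q"
proof (induction p rule: polynomial_induct)
  case (monomial m c)
  show ?case
  proof (induction q rule: polynomial_induct)
    case (monomial n d)
    have "poly_deriv G (Poly_Mapping.single m c * Poly_Mapping.single n d) =
        Const c * Const d * (monomial_deriv G m * Poly_Mapping.single n 1 +
          Poly_Mapping.single m 1 * monomial_deriv G n)"
      by (simp add: mult_single poly_deriv_single monomial_deriv_add Const_mult)
    also have "\<dots> = Const c * monomial_deriv G m * (Const d * Poly_Mapping.single n 1) +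
        (Const c * Poly_Mapping.single m 1) * (Const d * monomial_deriv G n)"
      by (simp add: algebra_simps)
    finally show ?case
      by (simp only: poly_deriv_single flip: single_eq_Const)
  next
    case (add p q)
    then show ?case by (simp add: poly_deriv_add algebra_simps)
  qed
next
  case (add p q)
  then show ?case by (simp add: poly_deriv_add algebra_simps)
qed

lemma is_formal_derivative_poly_deriv: "is_formal_derivative G (poly_deriv G)"
proof -
  have const: "poly_deriv G (Const c) = 0" for c
    by (simp add: Const_def poly_deriv_single monomial_deriv_def)
  have "poly_deriv G (Var a) = G a" for a
    by (simp add: Var_def poly_deriv_single monomial_deriv_def Const_def)
  then show ?thesis
    by (simp add: is_formal_derivative_def poly_deriv_add poly_deriv_mult const)
qed

lemma formal_derivative_unique:
  assumes D: "is_formal_derivative G D" and E: "is_formal_derivative G E"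
  shows "D = E"
proof
  have one: "F 1 = 0" if "is_formal_derivative G F" for F
  proof -
    have "F (1 * 1) = F 1 * 1 + 1 * F 1"
      using that unfolding is_formal_derivative_def by blast
    then show ?thesis by simp
  qed
  have mult: "D (u * Var a) = E (u * Var a)" if "D u = E u" for u a
    using D E that by (simp add: is_formal_derivative_def)
  have pow: "D (u * Var a ^ k) = E (u * Var a ^ k)" if "D u = E u" for u a k
  proof (induction k)
    case (Suc k)
    then show ?case using mult[of "u * Var a ^ k" a] by (simp add: mult_ac)
  qed (use that in simp)
  have Var_pow: "(Var a :: ('a, 'b) polynomial) ^ k =
      Poly_Mapping.single (Poly_Mapping.single a k) 1" for a k
  proof (induction k)
    case (Suc k)
    then show ?case by (simp add: Var_def mult_single flip: single_add)
  qed simp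
  have mon: "D (Poly_Mapping.single m 1) = E (Poly_Mapping.single m 1)" for m
  proof (induction m rule: update_induct)
    case const
    show ?case using one[OF D] one[OF E] by simp
  next
    case (update f a k)
    have "Poly_Mapping.update a k f = f + Poly_Mapping.single a k"
      using update(1)
      by (intro poly_mapping_eqI)
         (auto simp: lookup_add lookup_update lookup_single in_keys_iff when_def)
    then have "(Poly_Mapping.single (Poly_Mapping.update a k f) 1 :: ('a, 'b) polynomial) =
        Poly_Mapping.single f 1 * Var a ^ k"
      by (simp add: Var_pow mult_single)
    then show ?case using pow[OF update(3)] by simp
  qed
  fix p
  show "D p = E p"
  proof (induction p rule: polynomial_induct)
    case (monomial m c)
    show ?case
      unfolding single_eq_Const[of m c] using D E mon[of m]
      unfolding is_formal_derivative_def by metis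
  next
    case (add p q)
    then show ?case using D E unfolding is_formal_derivative_def by metis
  qed
qed

lemma ex1_formal_derivative: "\<exists>!D. is_formal_derivative G D"
  using is_formal_derivative_poly_deriv formal_derivative_unique by blast

lemma is_formal_derivative_formal_derivative: "is_formal_derivative G (formal_derivative G)"
  unfolding formal_derivative_def by (rule theI'[OF ex1_formal_derivative])

datatype letter = X | Y | Z

fun run_grammar :: "letter \<Rightarrow> (letter, 'a::comm_ring_1) polynomial" where
  "run_grammar X = Var X * Var Y"
| "run_grammar Y = Var Y * Var Z"
| "run_grammar Z = Var Y ^ 2"

definition changes_direction :: "(nat \<Rightarrow> nat) \<Rightarrow> nat \<Rightarrow> bool" where
  "changes_direction \<pi> i \<longleftrightarrow>
     \<pi> (i - 1) < \<pi> i \<and> \<pi> i > \<pi> (i + 1) \<or> \<pi> (i - 1) > \<pi> i \<and> \<pi> i < \<pi> (i + 1)"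

text \<open>Meaningful for \<open>n \<ge> 2\<close> only.\<close>

definition alternating_runs :: "nat \<Rightarrow> (nat \<Rightarrow> nat) \<Rightarrow> nat" where
  "alternating_runs n \<pi> = card {i \<in> {2..n - 1}. changes_direction \<pi> i} + 1"

definition run_count :: "nat \<Rightarrow> nat \<Rightarrow> nat" where
  "run_count n k = card {\<pi>. \<pi> permutes {1..n} \<and> alternating_runs n \<pi> = k}"

text \<open>
  A subsequence is given by its increasing list of positions. List positions count from \<open>0\<close>,
  so the descents of an alternating subsequence start at even \<open>j\<close>.
\<close>

definition alternating_subsequence :: "nat \<Rightarrow> (nat \<Rightarrow> nat) \<Rightarrow> nat list \<Rightarrow> bool" where
  "alternating_subsequence n \<pi> is \<longleftrightarrow>
     set is \<subseteq> {1..n} \<and> sorted_wrt (<) is \<and>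
     (\<forall>j. j + 1 < length is \<longrightarrow>
        (if even j then \<pi> (is ! j) > \<pi> (is ! (j + 1)) else \<pi> (is ! j) < \<pi> (is ! (j + 1))))"

definition as_length :: "nat \<Rightarrow> (nat \<Rightarrow> nat) \<Rightarrow> nat" where
  "as_length n \<pi> = Max {length is | is. alternating_subsequence n \<pi> is}"

lemma finite_alternating_subsequence: "finite {length is | is. alternating_subsequence n \<pi> is}"
proof (rule finite_subset)
  show "{length is | is. alternating_subsequence n \<pi> is} \<subseteq> {..n}"
  proof safe
    fix "is" assume *: "alternating_subsequence n \<pi> is"
    then have "length is = card (set is)"
      by (simp add: alternating_subsequence_def strict_sorted_iff distinct_card)
    also have "\<dots> \<le> card {1..n}"
      using * by (intro card_mono) (auto simp: alternating_subsequence_def)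
    finally show "length is \<le> n" by simp
  qed
qed simp

definition as_count :: "nat \<Rightarrow> nat \<Rightarrow> nat" where
  "as_count k n = card {\<pi>. \<pi> permutes {1..n} \<and> as_length n \<pi> = k}"

end

theory Submission
  imports Defs "HOL-Combinatorics.Multiset_Permutations" "HOL-Library.Sublist"
begin

text \<open>
  Prefixing a word by the letter \<open>0\<close> turns the length of its longest alternating subsequence
  into the number of its runs. If a word of \<open>n\<close> letters has \<open>c\<close> such runs, then among the
  \<open>n + 1\<close> positions for a new maximum, \<open>c\<close> keep their number, one raises it by one and \<open>n - c\<close>
  by two, just as \<open>D\<close> sends \<open>x y\<^sup>c z\<^sup>n\<^sup>-\<^sup>c\<close> to
  \<open>c x y\<^sup>c z\<^sup>n\<^sup>+\<^sup>1\<^sup>-\<^sup>c + x y\<^sup>c\<^sup>+\<^sup>1 z\<^sup>n\<^sup>-\<^sup>c + (n - c) x y\<^sup>c\<^sup>+\<^sup>2 z\<^sup>n\<^sup>-\<^sup>c\<^sup>-\<^sup>1\<close>. Without the prefix, a word of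
  \<open>n + 1\<close> letters has two positions that raise the number of runs by one, matching
  \<open>D (x\<^sup>2) = 2 x\<^sup>2 y\<close>.
\<close>

section \<open>Turns of a word\<close>

text \<open>\<open>turns up a w\<close> counts the changes of direction along \<open>a # w\<close>, the step leading
  to \<open>a\<close> having been upward iff \<open>up\<close>.\<close>

fun turns :: "bool \<Rightarrow> nat \<Rightarrow> nat list \<Rightarrow> nat" where
  "turns up a [] = 0"
| "turns up a (b # w) = (if up = (a < b) then 0 else 1) + turns (a < b) b w"

text \<open>One letter gets \<open>0\<close>, unlike in \<open>alternating_runs\<close>: it then
  contributes \<open>1\<close> to the sum, as the start of the iteration at \<open>x\<^sup>2\<close>
  requires.\<close>

fun runs :: "nat list \<Rightarrow> nat" where
  "runs (a # b # w) = Suc (turns (a < b) b w)"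
| "runs w = 0"

lemma turns_le_length: "turns up a w \<le> length w"
  by (induction up a w rule: turns.induct) (auto simp: le_Suc_eq)

lemma runs_less_length: "w \<noteq> [] \<Longrightarrow> runs w < length w"
  using turns_le_length by (cases w rule: runs.cases) (auto simp: less_Suc_eq_le)

text \<open>A list rather than a set, so that sums over all insertions unfold along the
  recursion.\<close>

fun inserts :: "'a \<Rightarrow> 'a list \<Rightarrow> 'a list list" where
  "inserts x [] = [[x]]"
| "inserts x (y # w) = (x # y # w) # map ((#) y) (inserts x w)"

lemma set_inserts: "v \<in> set (inserts x w) \<Longrightarrow> set v = insert x (set w)"
  by (induction w arbitrary: v) auto

lemma distinct_inserts:
  "v \<in> set (inserts x w) \<Longrightarrow> x \<notin> set w \<Longrightarrow> distinct w \<Longrightarrow> distinct v"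
  by (induction w arbitrary: v) (auto simp: set_inserts)

lemma removeAll_inserts: "v \<in> set (inserts x w) \<Longrightarrow> x \<notin> set w \<Longrightarrow> removeAll x v = w"
  by (induction w arbitrary: v) auto

lemma distinct_inserts_list: "x \<notin> set w \<Longrightarrow> distinct (inserts x w)"
  by (induction w) (auto simp: distinct_map)

lemma append_in_inserts: "u @ x # v \<in> set (inserts x (u @ v))"
  by (induction u) (cases v, auto)

lemma permutations_of_set_insert:
  assumes "x \<notin> A"
  shows "permutations_of_set (insert x A) = (\<Union>w\<in>permutations_of_set A. set (inserts x w))"
proof (intro equalityI subsetI)
  fix v assume "v \<in> permutations_of_set (insert x A)"
  then have v: "set v = insert x A" "distinct v" by (auto dest: permutations_of_setD)
  then obtain u t where ut: "v = u @ x # t" by (metis insertI1 split_list)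
  then have "u @ t \<in> permutations_of_set A" using v assms by (intro permutations_of_setI) auto
  then show "v \<in> (\<Union>w\<in>permutations_of_set A. set (inserts x w))"
    using ut append_in_inserts[of u x t] by blast
next
  fix v assume "v \<in> (\<Union>w\<in>permutations_of_set A. set (inserts x w))"
  then show "v \<in> permutations_of_set (insert x A)"
    using assms
    by (auto simp: permutations_of_set_def dest: set_inserts intro: distinct_inserts)
qed

text \<open>Deleting \<open>x\<close> recovers the word it was inserted into, so different words
  have disjoint sets of insertions.\<close>

lemma sum_permutations_of_set_insert:
  assumes "x \<notin> A"
  shows "(\<Sum>v\<in>permutations_of_set (insert x A). g v) =
    (\<Sum>w\<in>permutations_of_set A. \<Sum>v\<leftarrow>inserts x w. g v)"
proof -
  have x: "x \<notin> set w" if "w \<in> permutations_of_set A" for w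
    using that assms by (auto dest: permutations_of_setD)
  have "(\<Sum>v\<in>permutations_of_set (insert x A). g v) =
      (\<Sum>w\<in>permutations_of_set A. \<Sum>v\<in>set (inserts x w). g v)"
    unfolding permutations_of_set_insert[OF assms]
    by (rule sum.UNION_disjoint) (auto dest: removeAll_inserts x)
  also have "\<dots> = (\<Sum>w\<in>permutations_of_set A. \<Sum>v\<leftarrow>inserts x w. g v)"
    by (intro sum.cong refl) (simp add: sum_list_distinct_conv_sum_set distinct_inserts_list x)
  finally show ?thesis .
qed

text \<open>After an ascent to \<open>a\<close>, the extra summand \<open>f (1 + turns False a w)\<close> stands for
  inserting the maximum before \<open>a\<close>; without it the sum would also depend on whether \<open>w\<close>
  starts with an ascent.\<close>

lemma sum_turns_inserts:
  fixes f :: "nat \<Rightarrow> 'b::comm_ring_1"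
  assumes "a < M" "\<forall>b\<in>set w. b < M" "distinct (a # w)"
  shows
    "(\<Sum>v\<leftarrow>inserts M w. f (turns False a v)) =
      (let c = turns False a w in
        of_nat c * f c + f (c + 1) + of_nat (length w - c) * f (c + 2))"
    "f (1 + turns False a w) + (\<Sum>v\<leftarrow>inserts M w. f (turns True a v)) =
      (let c = turns True a w in
        of_nat (c + 1) * f c + f (c + 1) + of_nat (length w - c) * f (c + 2))"
  using assms
proof (induction w arbitrary: a f)
  case Nil
  {
    case 1
    then show ?case by simp
  next
    case 2
    then show ?case by simp
  }
next
  case (Cons b w)
  note le = turns_le_length[of False b w] turns_le_length[of True b w]
  {
    case 1
    then show ?case
    proof (cases "a < b")
      case True
      \<comment> \<open>\<open>M\<close> right before \<open>b\<close> supplies the extra summand of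
        the second claim for \<open>b\<close>; the shift of \<open>f\<close> accounts for the turn
        at \<open>a\<close>.\<close>
      then show ?thesis using 1 le Cons(2)[of b "\<lambda>k. f (Suc k)"]
        by (simp add: Let_def comp_def Suc_diff_le algebra_simps)
    next
      case False
      then show ?thesis using 1 le Cons(1)[of b f]
        by (simp add: Let_def comp_def Suc_diff_le algebra_simps)
    qed
  next
    case 2
    then show ?case
    proof (cases "a < b")
      case True
      then show ?thesis using 2 le Cons(2)[of b f]
        by (simp add: Let_def comp_def Suc_diff_le algebra_simps)
    next
      case False
      \<comment> \<open>The extra summand and \<open>M\<close> right before \<open>b\<close> both
        give \<open>f c\<close>, raising the \<open>c - 1\<close> copies from the first claim to
        \<open>c + 1\<close>.\<close>
      then show ?thesis using 2 le Cons(1)[of b "\<lambda>k. f (Suc k)"]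
        by (simp add: Let_def comp_def Suc_diff_le algebra_simps)
    qed
  }
qed

lemma sum_runs_inserts:
  fixes f :: "nat \<Rightarrow> 'b::comm_ring_1"
  assumes "\<forall>b\<in>set w. b < M" "distinct w" "w \<noteq> []"
  shows "(\<Sum>v\<leftarrow>inserts M w. f (runs v)) =
    (let c = runs w in
      of_nat c * f c + 2 * f (c + 1) + of_nat (length w - 1 - c) * f (c + 2))"
proof (cases w rule: runs.cases)
  case (1 a b u)
  note le = turns_le_length[of False b u] turns_le_length[of True b u]
  show ?thesis
  proof (cases "a < b")
    case True
    \<comment> \<open>\<open>M\<close> between \<open>a\<close> and \<open>b\<close> is the extra
      summand; \<open>M\<close> in front of \<open>a\<close> adds a run and gives the second
      \<open>f (c + 1)\<close>.\<close>
    then show ?thesis using assms 1 le sum_turns_inserts(2)[of b M u "\<lambda>k. f (Suc k)"]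
      by (simp add: Let_def comp_def Suc_diff_le algebra_simps)
  next
    case False
    \<comment> \<open>\<open>M\<close> in front of \<open>a\<close> only prolongs the first descent
      and gives one more \<open>f c\<close>; \<open>M\<close> between \<open>a\<close> and
      \<open>b\<close> gives the second \<open>f (c + 1)\<close>.\<close>
    then show ?thesis using assms 1 le sum_turns_inserts(1)[of b M u "\<lambda>k. f (Suc k)"]
      by (simp add: Let_def comp_def Suc_diff_le algebra_simps)
  qed
qed (use assms in auto)

section \<open>Permutations as words\<close>

abbreviation word :: "(nat \<Rightarrow> 'a) \<Rightarrow> nat \<Rightarrow> 'a list" where
  "word \<pi> n \<equiv> map \<pi> [1..<Suc n]"

lemma bij_betw_word:
  "bij_betw (\<lambda>\<pi>. word \<pi> n) {\<pi>. \<pi> permutes {1..n}} (permutations_of_set {1..n})"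
proof -
  let ?P = "{\<pi>. \<pi> permutes {1..n}}"
  have inj: "inj_on (\<lambda>\<pi>. word \<pi> n) ?P"
  proof (rule inj_onI)
    fix \<pi> \<sigma> assume "\<pi> \<in> ?P" "\<sigma> \<in> ?P" "word \<pi> n = word \<sigma> n"
    then have "\<pi> i = \<sigma> i" for i
      by (cases "i \<in> {1..n}") (auto simp: permutes_not_in map_eq_conv simp del: upt_Suc)
    then show "\<pi> = \<sigma>" by blast
  qed
  have "(\<lambda>\<pi>. word \<pi> n) ` ?P \<subseteq> permutations_of_set {1..n}"
    using permutations_of_set_image_permutes[of _ "{1..n}"]
    by (force intro!: permutations_of_setI simp: permutes_inj_on distinct_map
        permutes_image atLeastLessThanSuc_atLeastAtMost simp del: upt_Suc)
  \<comment> \<open>Surjectivity by counting: both sides have \<open>n!\<close> elements.\<close>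
  moreover have "card ((\<lambda>\<pi>. word \<pi> n) ` ?P) = card (permutations_of_set {1..n})"
    unfolding card_image[OF inj] by (simp add: card_permutations[of _ n])
  ultimately show ?thesis
    using inj by (simp add: bij_betw_def card_subset_eq del: upt_Suc)
qed

lemma card_permutes_word:
  assumes "\<And>\<pi>. \<pi> permutes {1..n} \<Longrightarrow> s \<pi> = t (word \<pi> n)"
  shows "card {\<pi>. \<pi> permutes {1..n} \<and> s \<pi> = k} =
    card {w \<in> permutations_of_set {1..n}. t w = k}"
proof -
  have "bij_betw (\<lambda>\<pi>. word \<pi> n) {\<pi> \<in> {\<pi>. \<pi> permutes {1..n}}. t (word \<pi> n) = k}
      {w \<in> permutations_of_set {1..n}. t w = k}"
    using bij_betw_word[of n] unfolding bij_betw_def inj_on_def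
    by (auto simp del: upt_Suc)
  moreover have "{\<pi> \<in> {\<pi>. \<pi> permutes {1..n}}. t (word \<pi> n) = k} =
      {\<pi>. \<pi> permutes {1..n} \<and> s \<pi> = k}"
    using assms by (auto simp del: upt_Suc)
  ultimately show ?thesis
    by (simp only: bij_betw_same_card)
qed

text \<open>Injectivity rules out equal neighbours, so comparing the truth values of two
  \<open><\<close> tests detects exactly the changes of direction.\<close>

lemma turns_map_upt:
  assumes "inj \<pi>" "i \<ge> 1"
  shows "turns (\<pi> (i - 1) < \<pi> i) (\<pi> i) (map \<pi> [Suc i..<Suc n]) =
    card {j \<in> {i..<n}. changes_direction \<pi> j}"
proof (use assms(2) in \<open>induction "n - i" arbitrary: i\<close>)
  case 0
  then show ?case by simp
next
  case (Suc d)
  have ne: "\<pi> (i - 1) \<noteq> \<pi> i" "\<pi> i \<noteq> \<pi> (i + 1)"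
    using assms(1) Suc(3) by (auto simp: inj_eq)
  have "{j \<in> {i..<n}. changes_direction \<pi> j} =
      (if changes_direction \<pi> i then {i} else {}) \<union> {j \<in> {Suc i..<n}. changes_direction \<pi> j}"
    using Suc(2) by (auto simp: le_eq_less_or_eq Suc_le_eq)
  then have "card {j \<in> {i..<n}. changes_direction \<pi> j} =
      of_bool (changes_direction \<pi> i) + card {j \<in> {Suc i..<n}. changes_direction \<pi> j}"
    by (simp add: card_insert_if)
  then show ?case
    using Suc(1)[of "Suc i"] Suc(2) ne
    by (auto simp: upt_conv_Cons changes_direction_def simp del: upt_Suc)
qed

lemma alternating_runs_eq_runs:
  assumes "\<pi> permutes {1..n}" "n \<ge> 2"
  shows "alternating_runs n \<pi> = runs (word \<pi> n)"
proof -
  have "word \<pi> n = \<pi> 1 # \<pi> 2 # map \<pi> [Suc 2..<Suc n]"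
    using assms(2) by (simp add: upt_conv_Cons numeral_2_eq_2 del: upt_Suc)
  moreover have "{2..n - 1} = {2..<n}" using assms(2) by auto
  ultimately show ?thesis
    using turns_map_upt[OF permutes_inj[OF assms(1)], of 2 n]
    by (simp add: alternating_runs_def)
qed

section \<open>Longest alternating subsequences\<close>

fun zigzag :: "bool \<Rightarrow> nat list \<Rightarrow> bool" where
  "zigzag up (a # b # w) \<longleftrightarrow> (if up then a < b else b < a) \<and> zigzag (\<not> up) (b # w)"
| "zigzag up w \<longleftrightarrow> True"

lemma zigzag_iff_nth:
  "zigzag up w \<longleftrightarrow> (\<forall>j. j + 1 < length w \<longrightarrow>
     (if even j = up then w ! j < w ! (j + 1) else w ! j > w ! (j + 1)))"
proof (induction up w rule: zigzag.induct)
  case (1 up a b w)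
  \<comment> \<open>Splitting off index \<open>0\<close> shifts the parity of \<open>j\<close>,
    which the switch from \<open>up\<close> to \<open>\<not> up\<close> absorbs.\<close>
  have all: "(\<forall>j. P j) \<longleftrightarrow> P 0 \<and> (\<forall>j. P (Suc j))" for P :: "nat \<Rightarrow> bool"
    by (metis not0_implies_Suc)
  show ?case
    unfolding zigzag.simps 1 by (subst (2) all) auto
qed auto

lemma zigzag_tl: "zigzag up (a # w) \<Longrightarrow> zigzag (\<not> up) w"
  by (cases w) auto

text \<open>Induction along the word. If the step to \<open>b\<close> keeps the direction, a start
  at \<open>a\<close> can be avoided at no loss of length; if it turns, the first letter of
  \<open>s\<close> is charged to the turn and the rest lies in \<open>b # w\<close>.\<close>

lemma length_zigzag_le:
  assumes "subseq s (a # w)" "distinct (a # w)" "zigzag (\<not> up) s"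
  shows "length s \<le> Suc (turns up a w)"
  using assms
proof (induction w arbitrary: s a up)
  case Nil
  then show ?case using list_emb_length[OF Nil(1)] by simp
next
  case (Cons b w)
  then have ab: "a < b \<or> b < a" by auto
  show ?case
  proof (cases s)
    case Nil
    then show ?thesis by simp
  next
    case s: (Cons c t)
    have t: "zigzag up t" using Cons.prems(3) s zigzag_tl[of "\<not> up"] by simp
    show ?thesis
    proof (cases "up = (a < b)")
      case same: True
      show ?thesis
      proof (cases "c = a")
        case True
        have "subseq t (b # w)" using Cons.prems(1) s True by simp
        show ?thesis
        proof (cases t)
          case Nil
          then show ?thesis using s by simp
        next
          case t: (Cons d t')
          \<comment> \<open>\<open>b\<close> lies beyond \<open>a\<close> in the direction of travel, so it may replace \<open>a\<close>, or \<open>t\<close>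
            starts with \<open>b\<close>, which the first step of \<open>s\<close> rules out.\<close>
          have "d \<noteq> b" "zigzag (\<not> up) (b # t)"
            using Cons.prems(3) s t True same ab by (auto split: if_splits)
          then have "subseq (b # t) (b # w)"
            using \<open>subseq t (b # w)\<close> t by simp
          then show ?thesis
            using Cons.IH[of "b # t" b up] Cons.prems same s \<open>zigzag (\<not> up) (b # t)\<close> by simp
        qed
      next
        case False
        then have "subseq s (b # w)" using Cons.prems(1) s by simp
        then show ?thesis using Cons.IH[of s b up] Cons.prems same by simp
      qed
    next
      case False
      have "subseq t (b # w)"
        using Cons.prems(1) s by (auto split: if_splits dest: subseq_Cons')
      then have "length t \<le> Suc (turns (\<not> up) b w)"
        using Cons.IH[of t b "\<not> up"] Cons.prems t by simp
      then show ?thesis using False s by (cases "a < b") auto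
    qed
  qed
qed

text \<open>The letters at which the word turns, together with the last one, form the zigzag. The
  bound on \<open>hd s\<close> is what allows \<open>a\<close> to be prepended at a turn.\<close>

lemma ex_zigzag:
  assumes "distinct (a # w)"
  shows "\<exists>s. subseq s (a # w) \<and> zigzag (\<not> up) s \<and> length s = Suc (turns up a w) \<and>
    (if up then a \<le> hd s else hd s \<le> a)"
  using assms
proof (induction w arbitrary: a up)
  case Nil
  show ?case by (intro exI[of _ "[a]"]) auto
next
  case (Cons b w)
  then have ab: "a < b \<or> b < a" by auto
  obtain s where s: "subseq s (b # w)" "zigzag (\<not> (a < b)) s"
      "length s = Suc (turns (a < b) b w)" "if a < b then b \<le> hd s else hd s \<le> b"
    using Cons.IH[of b "a < b"] Cons.prems by auto
  show ?case
  proof (cases "up = (a < b)")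
    case True
    then show ?thesis using s ab
      by (intro exI[of _ s]) (auto split: if_splits)
  next
    case False
    have "zigzag (\<not> up) (a # s)" using s ab False by (cases s) (auto split: if_splits)
    then show ?thesis using s False by (intro exI[of _ "a # s"]) auto
  qed
qed

lemma alternating_subsequence_iff:
  "alternating_subsequence n \<pi> is \<longleftrightarrow> subseq is [1..<Suc n] \<and> zigzag False (map \<pi> is)"
proof -
  have "set is \<subseteq> {1..n} \<and> sorted_wrt (<) is \<longleftrightarrow> subseq is [1..<Suc n]"
  proof
    assume "set is \<subseteq> {1..n} \<and> sorted_wrt (<) is"
    then show "subseq is [1..<Suc n]"
      by (intro sorted_subset_imp_subseq) (auto simp: strict_sorted_iff simp del: upt_Suc)
  next
    assume *: "subseq is [1..<Suc n]"
    then obtain N where "is = nths [1..<Suc n] N" by (auto simp: subseq_conv_nths)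
    moreover have "sorted_wrt (<) (nths [1..<Suc n] N)"
      by (simp add: strict_sorted_iff sorted_nths del: upt_Suc)
    ultimately show "set is \<subseteq> {1..n} \<and> sorted_wrt (<) is"
      using set_nths_subset[of "[1..<Suc n]" N] by auto
  qed
  then show ?thesis
    unfolding alternating_subsequence_def zigzag_iff_nth by auto
qed

lemma lengths_alternating_subsequence:
  "{length is | is. alternating_subsequence n \<pi> is} =
   {length s | s. subseq s (word \<pi> n) \<and> zigzag False s}"
proof -
  have "subseq s (word \<pi> n) \<longleftrightarrow> s \<in> map \<pi> ` {is. subseq is [1..<Suc n]}" for s
    by (auto simp: subseq_conv_nths nths_map simp del: upt_Suc)
  then have "{s. subseq s (word \<pi> n) \<and> zigzag False s} =
      map \<pi> ` {is. alternating_subsequence n \<pi> is}"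
    unfolding alternating_subsequence_iff by (auto simp del: upt_Suc)
  then have "length ` {s. subseq s (word \<pi> n) \<and> zigzag False s} =
      length ` {is. alternating_subsequence n \<pi> is}"
    by (simp add: image_image)
  then show ?thesis by (simp only: setcompr_eq_image)
qed

text \<open>Since \<open>0\<close> lies below all letters, prefixing it to a zigzag that starts
  downward gives one that starts upward. The direction \<open>False\<close> into \<open>0\<close>
  makes the first ascent count as a turn.\<close>

lemma as_length_eq_turns:
  assumes "\<pi> permutes {1..n}"
  shows "as_length n \<pi> = turns False 0 (word \<pi> n)"
proof -
  let ?w = "word \<pi> n"
  have "?w \<in> permutations_of_set {1..n}"
    using bij_betw_apply[OF bij_betw_word] assms by blast
  note w = permutations_of_setD[OF this]
  then have dist: "distinct (0 # ?w)" by (simp del: upt_Suc set_map set_upt)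
  show ?thesis
    unfolding as_length_def
  proof (rule Max_eqI[OF finite_alternating_subsequence], unfold lengths_alternating_subsequence)
    fix l assume "l \<in> {length s | s. subseq s ?w \<and> zigzag False s}"
    then obtain s where s: "l = length s" "subseq s ?w" "zigzag False s" by blast
    have "set s \<subseteq> {1..n}" using s(2) w(1) by (metis subseq_conv_nths set_nths_subset)
    then have "zigzag True (0 # s)" using s(3) by (cases s) auto
    then show "l \<le> turns False 0 ?w"
      using length_zigzag_le[of "0 # s" 0 ?w False] s dist by (simp del: upt_Suc)
  next
    \<comment> \<open>The bound in \<open>ex_zigzag\<close> reads \<open>hd s \<le> 0\<close> here,
      so the zigzag starts with the prefix, which is then dropped.\<close>
    obtain s where s: "subseq s (0 # ?w)" "zigzag True s"
        "length s = Suc (turns False 0 ?w)" "hd s = 0"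
      using ex_zigzag[OF dist, of False] by auto
    then obtain t where t: "s = 0 # t" by (cases s) auto
    then show "turns False 0 ?w \<in> {length s | s. subseq s ?w \<and> zigzag False s}"
      using s zigzag_tl[of True 0 t]
      by (intro CollectI exI[of _ t]) (simp del: upt_Suc)
  qed
qed

section \<open>Iterating the derivation\<close>

text \<open>One induction for both identities: \<open>m\<close> is the exponent of \<open>x\<close>
  in \<open>u\<close>, and \<open>step\<close> is the recurrence obtained by inserting a new
  maximum.\<close>

lemma derivative_iterate:
  fixes D :: "(letter, 'a::comm_ring_1) polynomial \<Rightarrow> (letter, 'a) polynomial"
    and W :: "nat \<Rightarrow> 'w set" and t :: "'w \<Rightarrow> nat" and n :: nat
  assumes D: "is_formal_derivative run_grammar D"
    and u: "D u = of_nat m * Var Y * u"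
    and init: "(\<Sum>w\<in>W 0. Var Y ^ t w * Var Z ^ (0 - t w)) = (1 :: (letter, 'a) polynomial)"
    and le: "\<And>n w. w \<in> W n \<Longrightarrow> t w \<le> n"
    and step: "\<And>n (f :: nat \<Rightarrow> (letter, 'a) polynomial). (\<Sum>v\<in>W (Suc n). f (t v)) =
      (\<Sum>w\<in>W n. of_nat (t w) * f (t w) + of_nat m * f (t w + 1) + of_nat (n - t w) * f (t w + 2))"
  shows "(D ^^ n) u = u * (\<Sum>w\<in>W n. Var Y ^ t w * Var Z ^ (n - t w))"
proof (induction n)
  case 0
  show ?case using init by simp
next
  case (Suc n)
  let ?y = "Var Y :: (letter, 'a) polynomial" and ?z = "Var Z :: (letter, 'a) polynomial"
  have add: "D (p + q) = D p + D q" and mult: "D (p * q) = D p * q + p * D q"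
    and y: "D ?y = ?y * ?z" and z: "D ?z = ?y ^ 2" for p q
    using D by (auto simp: is_formal_derivative_def)
  have zero: "D 0 = 0" using add[of 0 0] by simp
  have one: "D 1 = 0" using mult[of 1 1] by simp
  have sum: "D (\<Sum>w\<in>A. g w) = (\<Sum>w\<in>A. D (g w))" for A and g :: "'w \<Rightarrow> _"
    by (induction A rule: infinite_finite_induct) (auto simp: zero add)
  have ypow: "D (?y ^ c) = of_nat c * ?y ^ c * ?z" for c
    by (induction c) (auto simp: one mult y algebra_simps)
  have zpow: "D (?z ^ d) = of_nat d * ?y ^ 2 * ?z ^ (d - 1)" for d
  proof (induction d)
    case (Suc d)
    then show ?case by (cases d) (auto simp: mult z algebra_simps)
  qed (simp add: one)
  \<comment> \<open>The terms on the right come from \<open>y\<close>, \<open>u\<close> and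
    \<open>z\<close>, in this order. Where \<open>Suc n - (t w + 2)\<close> is truncated, its
    coefficient \<open>n - t w\<close> vanishes.\<close>
  have summand: "of_nat m * ?y * (?y ^ t w * ?z ^ (n - t w)) + D (?y ^ t w * ?z ^ (n - t w)) =
      of_nat (t w) * (?y ^ t w * ?z ^ (Suc n - t w))
      + of_nat m * (?y ^ (t w + 1) * ?z ^ (Suc n - (t w + 1)))
      + of_nat (n - t w) * (?y ^ (t w + 2) * ?z ^ (Suc n - (t w + 2)))" if "w \<in> W n" for w
    using le[OF that]
    by (simp add: mult ypow zpow Suc_diff_le power2_eq_square algebra_simps)
  have "(D ^^ Suc n) u = u * (\<Sum>w\<in>W n.
      of_nat m * ?y * (?y ^ t w * ?z ^ (n - t w)) + D (?y ^ t w * ?z ^ (n - t w)))"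
    by (simp add: Suc mult sum u sum.distrib sum_distrib_left algebra_simps)
  also have "\<dots> = u * (\<Sum>w\<in>W (Suc n). ?y ^ t w * ?z ^ (Suc n - t w))"
    unfolding step[of "\<lambda>k. ?y ^ k * ?z ^ (Suc n - k)" n]
    by (intro arg_cong[where f = "(*) u"] sum.cong refl summand)
  finally show ?case .
qed

lemma sum_by_value:
  fixes g :: "nat \<Rightarrow> 'b::comm_ring_1"
  assumes "finite A" "\<And>w. w \<in> A \<Longrightarrow> t w \<in> {1..n}"
  shows "(\<Sum>w\<in>A. g (t w)) = (\<Sum>k = 1..n. of_nat (card {w \<in> A. t w = k}) * g k)"
proof -
  have "(\<Sum>w\<in>A. g (t w)) = (\<Sum>k = 1..n. \<Sum>w | w \<in> A \<and> t w = k. g (t w))"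
    using assms by (intro sum.group[symmetric]) auto
  also have "\<dots> = (\<Sum>k = 1..n. of_nat (card {w \<in> A. t w = k}) * g k)"
    by (intro sum.cong refl) simp
  finally show ?thesis .
qed

theorem theorem6:
  fixes n :: nat
  assumes "n \<ge> 1"
  shows "let D = formal_derivative run_grammar;
             x = (Var X :: (letter, 'a::comm_ring_1) polynomial); y = Var Y; z = Var Z
         in (D ^^ n) (x ^ 2) =
              x ^ 2 * (\<Sum>k = 1..n. of_nat (run_count (n + 1) k) * y ^ k * z ^ (n - k)) \<and>
            (D ^^ n) x =
              x * (\<Sum>k = 1..n. of_nat (as_count k n) * y ^ k * z ^ (n - k))"
proof -
  let ?D = "formal_derivative run_grammar :: (letter, 'a) polynomial \<Rightarrow> _"
  let ?x = "Var X :: (letter, 'a) polynomial"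
    and ?y = "Var Y :: (letter, 'a) polynomial" and ?z = "Var Z :: (letter, 'a) polynomial"
  let ?W = "\<lambda>n. permutations_of_set {1..n::nat}"
  have D: "is_formal_derivative run_grammar ?D"
    by (rule is_formal_derivative_formal_derivative)
  then have mult: "?D (p * q) = ?D p * q + p * ?D q" and x: "?D ?x = ?x * ?y" for p q
    by (auto simp: is_formal_derivative_def)
  have W: "set w = {1..n}" "distinct w" "length w = n" if "w \<in> ?W n" for w n
    using that length_finite_permutations_of_set[OF that] by (auto dest: permutations_of_setD)
  have "(?D ^^ n) (?x ^ 2) = ?x ^ 2 * (\<Sum>w\<in>?W (n + 1). ?y ^ runs w * ?z ^ (n - runs w))"
  \<comment> \<open>Stage \<open>n\<close> uses words of \<open>n + 1\<close> letters, starting from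
    the single word of length one.\<close>
  proof (rule derivative_iterate[OF D, where m = 2])
    show "?D (?x ^ 2) = of_nat 2 * Var Y * ?x ^ 2"
      by (simp add: power2_eq_square mult x algebra_simps)
    show "(\<Sum>w\<in>?W (0 + 1). ?y ^ runs w * ?z ^ (0 - runs w)) = 1" by simp
    show "runs w \<le> n" if "w \<in> ?W (n + 1)" for w n
      using W[OF that] runs_less_length[of w] by force
    show "(\<Sum>v\<in>?W (Suc n + 1). f (runs v)) =
      (\<Sum>w\<in>?W (n + 1). of_nat (runs w) * f (runs w) + of_nat 2 * f (runs w + 1) +
        of_nat (n - runs w) * f (runs w + 2))" for n and f :: "nat \<Rightarrow> (letter, 'a) polynomial"
    proof -
      have "(\<Sum>v\<leftarrow>inserts (Suc (Suc n)) w. f (runs v)) =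
          of_nat (runs w) * f (runs w) + of_nat 2 * f (runs w + 1) +
          of_nat (n - runs w) * f (runs w + 2)" if "w \<in> ?W (n + 1)" for w
        using W[OF that] sum_runs_inserts[of w "Suc (Suc n)" f] by (force simp: Let_def)
      then show ?thesis
        by (simp add: atLeastAtMostSuc_conv[of "Suc 0" "Suc n"] sum_permutations_of_set_insert)
    qed
  qed
  also have "(\<Sum>w\<in>?W (n + 1). ?y ^ runs w * ?z ^ (n - runs w)) =
      (\<Sum>k = 1..n. of_nat (run_count (n + 1) k) * (?y ^ k * ?z ^ (n - k)))"
  proof (subst sum_by_value[where n = n and t = runs])
    \<comment> \<open>Since \<open>n \<ge> 1\<close>, the word has at least two letters and hence a
      run.\<close>
    show "runs w \<in> {1..n}" if "w \<in> ?W (n + 1)" for w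
      using W[OF that] runs_less_length[of w] assms by (cases w rule: runs.cases) auto
    show "(\<Sum>k = 1..n. of_nat (card {w \<in> ?W (n + 1). runs w = k}) * (?y ^ k * ?z ^ (n - k))) =
        (\<Sum>k = 1..n. of_nat (run_count (n + 1) k) * (?y ^ k * ?z ^ (n - k)))"
      unfolding run_count_def using assms
      by (subst card_permutes_word[where t = runs]) (simp_all add: alternating_runs_eq_runs del: upt_Suc)
  qed simp
  finally have R: "(?D ^^ n) (?x ^ 2) =
      ?x ^ 2 * (\<Sum>k = 1..n. of_nat (run_count (n + 1) k) * (?y ^ k * ?z ^ (n - k)))" .
  let ?t = "turns False 0"
  have "(?D ^^ n) ?x = ?x * (\<Sum>w\<in>?W n. ?y ^ ?t w * ?z ^ (n - ?t w))"
  proof (rule derivative_iterate[OF D, where m = 1])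
    show "?D ?x = of_nat 1 * Var Y * ?x" by (simp add: x mult.commute)
    show "(\<Sum>w\<in>?W 0. ?y ^ ?t w * ?z ^ (0 - ?t w)) = 1" by simp
    show "?t w \<le> n" if "w \<in> ?W n" for w n
      using W[OF that] turns_le_length[of False 0 w] by simp
    show "(\<Sum>v\<in>?W (Suc n). f (?t v)) =
      (\<Sum>w\<in>?W n. of_nat (?t w) * f (?t w) + of_nat 1 * f (?t w + 1) +
        of_nat (n - ?t w) * f (?t w + 2))" for n and f :: "nat \<Rightarrow> (letter, 'a) polynomial"
    proof -
      have "(\<Sum>v\<leftarrow>inserts (Suc n) w. f (?t v)) =
          of_nat (?t w) * f (?t w) + of_nat 1 * f (?t w + 1) +
          of_nat (n - ?t w) * f (?t w + 2)" if "w \<in> ?W n" for w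
        \<comment> \<open>The prefix \<open>0\<close> acts as the letter \<open>a\<close>: it is
          below \<open>M\<close> and differs from all letters of \<open>w\<close>.\<close>
        using W[OF that] sum_turns_inserts(1)[of 0 "Suc n" w f] by (auto simp: Let_def)
      then show ?thesis
        by (simp add: atLeastAtMostSuc_conv sum_permutations_of_set_insert)
    qed
  qed
  also have "(\<Sum>w\<in>?W n. ?y ^ ?t w * ?z ^ (n - ?t w)) =
      (\<Sum>k = 1..n. of_nat (as_count k n) * (?y ^ k * ?z ^ (n - k)))"
  proof (subst sum_by_value[where n = n and t = ?t])
    \<comment> \<open>The ascent from \<open>0\<close> to the first letter is already a
      turn.\<close>
    show "?t w \<in> {1..n}" if "w \<in> ?W n" for w
      using W[OF that] turns_le_length[of False 0 w] assms by (cases w) auto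
    show "(\<Sum>k = 1..n. of_nat (card {w \<in> ?W n. ?t w = k}) * (?y ^ k * ?z ^ (n - k))) =
        (\<Sum>k = 1..n. of_nat (as_count k n) * (?y ^ k * ?z ^ (n - k)))"
      unfolding as_count_def
      by (subst card_permutes_word[where t = ?t]) (simp_all add: as_length_eq_turns del: upt_Suc)
  qed simp
  finally show ?thesis
    using R by (simp add: Let_def mult.assoc)
qed

end
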